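(* Let $\mathbf{A}$ be a strongly Fregean algebra with a principal congruence term $e$. Then $M$ preserves the equivalence operation, that is, $$M(e(a,b))=M(a)\leftrightarrow M(b)$$ for all $a,b\in A$.
   Context: Conventions. $\mathsf{Con}(\mathbf{A})$ is the congruence lattice of an algebra $\mathbf{A}$, and $\mathsf{Cm}(\mathbf{A})$ is the set of completely meet irreducible congruences. The language contains a distinguished constant term $1$. $\Theta_{\mathbf{A}}(c,d)$ is the least congruence containing $(c,d)$. $\mathbf{A}$ is congruence orderable if $\Theta_{\mathbf{A}}(1,a)=\Theta_{\mathbf{A}}(1,b)$ implies $a=b$ for $a,b\in A$; it is $1$-regular if $1/\alpha=1/\beta$ implies $\alpha=\beta$ for $\alpha,\beta\in\mathsf{Con}(\mathbf{A})$; it is Fregean if it is both. $\mathbf{A}$ is strongly Fregean if every homomorphic image of $\mathbf{A}$ is Fregean (with respect to $1$) and the variety generated by $\mathbf{A}$ is congruence modular. A principal congruence term of $\mathbf{A}$ is a binary term $e$ with $\Theta_{\mathbf{A}}(a,b)=\Theta_{\mathbf{A}}(1,e(a,b))$ for all $a,b\in A$. For $c\in A$, $M(c):=\{\mu\in\mathsf{Cm}(\mathbf{A}):(1,c)\in\mu\}$, an upward closed subset of the poset $(\mathsf{Cm}(\mathbf{A}),\le)$. For upward closed $S,T\subset\mathsf{Cm}(\mathbf{A})$, $S\leftrightarrow T:=((S\div T)\downarrow)'$, where $\div$ is symmetric difference, $X\!\downarrow\,=\{\mu\in\mathsf{Cm}(\mathbf{A}):\mu\le\varphi\text{ for some }\varphi\in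 X\}$ and $'$ is complement in $\mathsf{Cm}(\mathbf{A})$; equivalently, $S\leftrightarrow T$ is the largest upward closed $C$ with $C\cap S=C\cap T$. *)

theory Defs
  imports "HOL-Algebra.Complete_Lattice" "HOL-Library.Countable_Set"
begin

section \<open>Algebras, terms, congruences\<close>

text \<open>
  A language is a partial map from symbols to arities; its operation symbols are the elements
  of the domain.  Only the values of \<open>interp\<close> on argument lists of the right length with
  entries in the carrier are meaningful.
\<close>

record ('f, 'a) ualg = "'a partial_object" +
  interp :: "'f \<Rightarrow> 'a list \<Rightarrow> 'a"

definition ualgebra :: "('f \<rightharpoonup> nat) \<Rightarrow> ('f, 'a) ualg \<Rightarrow> bool" where
  "ualgebra L A \<longleftrightarrow> carrier A \<noteq> {} \<and>
     (\<forall>f xs. L f = Some (length xs) \<longrightarrow> set xs \<subseteq> carrier A \<longrightarrow> interp A f xs \<in> carrier A)"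

datatype ('f, vars: 'v) tm = Var 'v | App 'f "('f, 'v) tm list"

fun wf_tm :: "('f \<rightharpoonup> nat) \<Rightarrow> ('f, 'v) tm \<Rightarrow> bool" where
  "wf_tm L (Var v) \<longleftrightarrow> True"
| "wf_tm L (App f ts) \<longleftrightarrow> L f = Some (length ts) \<and> (\<forall>t \<in> set ts. wf_tm L t)"

primrec eval_tm :: "('f, 'a) ualg \<Rightarrow> ('v \<Rightarrow> 'a) \<Rightarrow> ('f, 'v) tm \<Rightarrow> 'a" where
  "eval_tm A \<rho> (Var v) = \<rho> v"
| "eval_tm A \<rho> (App f ts) = interp A f (map (eval_tm A \<rho>) ts)"

definition congruence :: "('f \<rightharpoonup> nat) \<Rightarrow> ('f, 'a) ualg \<Rightarrow> ('a \<times> 'a) set \<Rightarrow> bool" where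
  "congruence L A \<theta> \<longleftrightarrow> equiv (carrier A) \<theta> \<and>
     (\<forall>f xs ys. L f = Some (length xs) \<longrightarrow> list_all2 (\<lambda>x y. (x, y) \<in> \<theta>) xs ys
        \<longrightarrow> (interp A f xs, interp A f ys) \<in> \<theta>)"

definition Con :: "('f \<rightharpoonup> nat) \<Rightarrow> ('f, 'a) ualg \<Rightarrow> ('a \<times> 'a) set gorder" where
  "Con L A = \<lparr>carrier = {\<theta>. congruence L A \<theta>}, eq = (=), le = (\<subseteq>)\<rparr>"

definition Theta :: "('f \<rightharpoonup> nat) \<Rightarrow> ('f, 'a) ualg \<Rightarrow> 'a \<Rightarrow> 'a \<Rightarrow> ('a \<times> 'a) set" where
  "Theta L A c d = \<Inter>{\<theta>. congruence L A \<theta> \<and> (c, d) \<in> \<theta>}"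

text \<open>The index set may be empty, so the top element is not completely meet irreducible.\<close>

definition completely_meet_irreducible :: "'a gorder \<Rightarrow> 'a \<Rightarrow> bool" where
  "completely_meet_irreducible P m \<longleftrightarrow> m \<in> carrier P \<and>
     (\<forall>S. S \<subseteq> carrier P \<longrightarrow> \<Sqinter>\<^bsub>P\<^esub>S = m \<longrightarrow> m \<in> S)"

definition Cm :: "('f \<rightharpoonup> nat) \<Rightarrow> ('f, 'a) ualg \<Rightarrow> ('a \<times> 'a) set set" where
  "Cm L A = {\<mu>. completely_meet_irreducible (Con L A) \<mu>}"

definition modular_lattice :: "'a gorder \<Rightarrow> bool" where
  "modular_lattice P \<longleftrightarrow> lattice P \<and>
     (\<forall>x \<in> carrier P. \<forall>y \<in> carrier P. \<forall>z \<in> carrier P. x \<sqsubseteq>\<^bsub>P\<^esub> z \<longrightarrow>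
        x \<squnion>\<^bsub>P\<^esub> (y \<sqinter>\<^bsub>P\<^esub> z) = (x \<squnion>\<^bsub>P\<^esub> y) \<sqinter>\<^bsub>P\<^esub> z)"


section \<open>Homomorphic images and the generated variety\<close>

definition alg_hom :: "('f \<rightharpoonup> nat) \<Rightarrow> ('f, 'a) ualg \<Rightarrow> ('f, 'b) ualg \<Rightarrow> ('a \<Rightarrow> 'b) \<Rightarrow> bool" where
  "alg_hom L A B h \<longleftrightarrow> h ` carrier A \<subseteq> carrier B \<and>
     (\<forall>f xs. L f = Some (length xs) \<longrightarrow> set xs \<subseteq> carrier A
        \<longrightarrow> h (interp A f xs) = interp B f (map h xs))"

definition homomorphic_image :: "('f \<rightharpoonup> nat) \<Rightarrow> ('f, 'a) ualg \<Rightarrow> ('f, 'b) ualg \<Rightarrow> bool" where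
  "homomorphic_image L A B \<longleftrightarrow> ualgebra L B \<and> (\<exists>h. alg_hom L A B h \<and> h ` carrier A = carrier B)"

definition satisfies :: "('f, 'a) ualg \<Rightarrow> ('f, nat) tm \<Rightarrow> ('f, nat) tm \<Rightarrow> bool" where
  "satisfies A s t \<longleftrightarrow> (\<forall>\<rho>. range \<rho> \<subseteq> carrier A \<longrightarrow> eval_tm A \<rho> s = eval_tm A \<rho> t)"

text \<open>A variety is a class of algebras defined by identities; the least one containing \<open>A\<close>
  consists of the algebras that satisfy all identities of \<open>A\<close>.\<close>

definition in_variety :: "('f \<rightharpoonup> nat) \<Rightarrow> ('f, 'a) ualg \<Rightarrow> ('f, 'b) ualg \<Rightarrow> bool" where
  "in_variety L A B \<longleftrightarrow> ualgebra L B \<and>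
     (\<forall>s t. wf_tm L s \<longrightarrow> wf_tm L t \<longrightarrow> satisfies A s t \<longrightarrow> satisfies B s t)"

text \<open>
  HOL cannot quantify over all carrier types inside a definition.  The type below is large
  enough: up to isomorphism it contains every countably generated algebra of the variety (each
  is a quotient of the algebra of terms in the variables \<open>nat\<close>), and a failure of modularity
  in a congruence lattice already occurs in a finitely generated subalgebra.  Lemma
  \<open>variety_modular_all\<close> derives modularity over every carrier type.
\<close>

definition variety_congruence_modular :: "('f \<rightharpoonup> nat) \<Rightarrow> ('f, 'a) ualg \<Rightarrow> bool" where
  "variety_congruence_modular L A \<longleftrightarrow>
     (\<forall>B :: ('f, ('f, nat) tm set) ualg. in_variety L A B \<longrightarrow> modular_lattice (Con L B))"


section \<open>Fregean algebras\<close>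

text \<open>
  The constant term \<open>1\<close> is a term whose value does not depend on the variables, such as a nullary
  operation symbol, or \<open>x \<leftrightarrow> x\<close> in equivalential algebras, whose language has no nullary symbol.
\<close>

definition constant_term :: "('f \<rightharpoonup> nat) \<Rightarrow> ('f, 'a) ualg \<Rightarrow> ('f, nat) tm \<Rightarrow> bool" where
  "constant_term L A t \<longleftrightarrow> wf_tm L t \<and>
     (\<exists>c. \<forall>\<rho>. range \<rho> \<subseteq> carrier A \<longrightarrow> eval_tm A \<rho> t = c)"

definition const_val :: "('f, 'a) ualg \<Rightarrow> ('f, nat) tm \<Rightarrow> 'a" where
  "const_val A t = (THE c. \<forall>\<rho>. range \<rho> \<subseteq> carrier A \<longrightarrow> eval_tm A \<rho> t = c)"

definition congruence_orderable :: "('f \<rightharpoonup> nat) \<Rightarrow> ('f, 'a) ualg \<Rightarrow> ('f, nat) tm \<Rightarrow> bool" where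
  "congruence_orderable L A one \<longleftrightarrow>
     (\<forall>a \<in> carrier A. \<forall>b \<in> carrier A.
        Theta L A (const_val A one) a = Theta L A (const_val A one) b \<longrightarrow> a = b)"

definition one_regular :: "('f \<rightharpoonup> nat) \<Rightarrow> ('f, 'a) ualg \<Rightarrow> ('f, nat) tm \<Rightarrow> bool" where
  "one_regular L A one \<longleftrightarrow>
     (\<forall>\<alpha> \<in> carrier (Con L A). \<forall>\<beta> \<in> carrier (Con L A).
        \<alpha> `` {const_val A one} = \<beta> `` {const_val A one} \<longrightarrow> \<alpha> = \<beta>)"

definition fregean :: "('f \<rightharpoonup> nat) \<Rightarrow> ('f, 'a) ualg \<Rightarrow> ('f, nat) tm \<Rightarrow> bool" where
  "fregean L A one \<longleftrightarrow> congruence_orderable L A one \<and> one_regular L A one"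

text \<open>The carrier type \<open>'a set\<close> accommodates all quotients of \<open>A\<close>, hence all homomorphic images
  up to isomorphism; lemma \<open>strongly_fregean_all\<close> removes the restriction.\<close>

definition strongly_fregean :: "('f \<rightharpoonup> nat) \<Rightarrow> ('f, 'a) ualg \<Rightarrow> ('f, nat) tm \<Rightarrow> bool" where
  "strongly_fregean L A one \<longleftrightarrow>
     (\<forall>B :: ('f, 'a set) ualg. homomorphic_image L A B \<longrightarrow> fregean L B one) \<and>
     variety_congruence_modular L A"

definition binary_val :: "('f, 'a) ualg \<Rightarrow> ('f, nat) tm \<Rightarrow> 'a \<Rightarrow> 'a \<Rightarrow> 'a" where
  "binary_val A e a b = eval_tm A (\<lambda>i. if i = 0 then a else b) e"

definition principal_congruence_term ::
  "('f \<rightharpoonup> nat) \<Rightarrow> ('f, 'a) ualg \<Rightarrow> ('f, nat) tm \<Rightarrow> ('f, nat) tm \<Rightarrow> bool" where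
  "principal_congruence_term L A one e \<longleftrightarrow> wf_tm L e \<and> vars e \<subseteq> {0, 1} \<and>
     (\<forall>a \<in> carrier A. \<forall>b \<in> carrier A.
        Theta L A a b = Theta L A (const_val A one) (binary_val A e a b))"


section \<open>The map into the upward closed sets of completely meet irreducible congruences\<close>

definition M :: "('f \<rightharpoonup> nat) \<Rightarrow> ('f, 'a) ualg \<Rightarrow> ('f, nat) tm \<Rightarrow> 'a \<Rightarrow> ('a \<times> 'a) set set" where
  "M L A one c = {\<mu> \<in> Cm L A. (const_val A one, c) \<in> \<mu>}"

definition down_Cm ::
  "('f \<rightharpoonup> nat) \<Rightarrow> ('f, 'a) ualg \<Rightarrow> ('a \<times> 'a) set set \<Rightarrow> ('a \<times> 'a) set set" where
  "down_Cm L A X = {\<mu> \<in> Cm L A. \<exists>\<phi> \<in> X. \<mu> \<sqsubseteq>\<^bsub>Con L A\<^esub> \<phi>}"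

definition equiv_Cm :: "('f \<rightharpoonup> nat) \<Rightarrow> ('f, 'a) ualg \<Rightarrow> ('a \<times> 'a) set set \<Rightarrow> ('a \<times> 'a) set set
    \<Rightarrow> ('a \<times> 'a) set set" where
  "equiv_Cm L A S T = Cm L A - down_Cm L A (sym_diff S T)"

section \<open>The definitions do not depend on the carrier types chosen\<close>

lemma congruenceD:
  assumes "congruence L A \<theta>"
  shows "\<theta> \<subseteq> carrier A \<times> carrier A" "x \<in> carrier A \<Longrightarrow> (x, x) \<in> \<theta>"
    "(x, y) \<in> \<theta> \<Longrightarrow> (y, x) \<in> \<theta>" "(x, y) \<in> \<theta> \<Longrightarrow> (y, z) \<in> \<theta> \<Longrightarrow> (x, z) \<in> \<theta>"
    "L f = Some (length xs) \<Longrightarrow> list_all2 (\<lambda>x y. (x, y) \<in> \<theta>) xs ys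
       \<Longrightarrow> (interp A f xs, interp A f ys) \<in> \<theta>"
  using assms unfolding congruence_def equiv_def refl_on_def
  by (auto dest: symD transD)

lemma congruenceI:
  assumes "\<theta> \<subseteq> carrier A \<times> carrier A" "\<And>x. x \<in> carrier A \<Longrightarrow> (x, x) \<in> \<theta>"
    "\<And>x y. (x, y) \<in> \<theta> \<Longrightarrow> (y, x) \<in> \<theta>"
    "\<And>x y z. (x, y) \<in> \<theta> \<Longrightarrow> (y, z) \<in> \<theta> \<Longrightarrow> (x, z) \<in> \<theta>"
    "\<And>f xs ys. L f = Some (length xs) \<Longrightarrow> list_all2 (\<lambda>x y. (x, y) \<in> \<theta>) xs ys
       \<Longrightarrow> (interp A f xs, interp A f ys) \<in> \<theta>"
  shows "congruence L A \<theta>"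
proof -
  have "sym \<theta>" "trans \<theta>" by (rule symI, erule assms(3), rule transI, erule (1) assms(4))
  then show ?thesis using assms(1,2,5) unfolding congruence_def equiv_def refl_on_def by blast
qed

lemma list_all2_carrier:
  "list_all2 (\<lambda>x y. (x, y) \<in> \<theta>) xs ys \<Longrightarrow> \<theta> \<subseteq> S \<times> S \<Longrightarrow> set xs \<subseteq> S \<and> set ys \<subseteq> S"
  by (induction rule: list_all2_induct) auto

lemma congruence_full:
  assumes "ualgebra L A"
  shows "congruence L A (carrier A \<times> carrier A)"
proof (rule congruenceI)
  fix f xs ys
  assume "L f = Some (length xs)" and r: "list_all2 (\<lambda>x y. (x, y) \<in> carrier A \<times> carrier A) xs ys"
  moreover have "length xs = length ys" using r by (rule list_all2_lengthD)
  moreover have "set xs \<subseteq> carrier A \<and> set ys \<subseteq> carrier A" using list_all2_carrier[OF r] by blast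
  ultimately show "(interp A f xs, interp A f ys) \<in> carrier A \<times> carrier A"
    using assms unfolding ualgebra_def by (metis SigmaI)
qed auto

lemma congruence_Inter:
  assumes "S \<noteq> {}" "\<And>\<theta>. \<theta> \<in> S \<Longrightarrow> congruence L A \<theta>"
  shows "congruence L A (\<Inter>S)"
proof (rule congruenceI)
  fix f xs ys
  assume L: "L f = Some (length xs)" and r: "list_all2 (\<lambda>x y. (x, y) \<in> \<Inter>S) xs ys"
  show "(interp A f xs, interp A f ys) \<in> \<Inter>S"
  proof
    fix \<theta> assume \<theta>: "\<theta> \<in> S"
    have "list_all2 (\<lambda>x y. (x, y) \<in> \<theta>) xs ys"
      by (rule list_all2_mono[OF r]) (use \<theta> in blast)
    then show "(interp A f xs, interp A f ys) \<in> \<theta>"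
      using congruenceD(5)[OF assms(2)[OF \<theta>] L] by blast
  qed
qed (use assms in \<open>auto dest: congruenceD\<close>)

lemma congruence_Int:
  assumes "congruence L A \<alpha>" "congruence L A \<beta>"
  shows "congruence L A (\<alpha> \<inter> \<beta>)"
proof -
  have "congruence L A (\<Inter>{\<alpha>, \<beta>})" by (rule congruence_Inter) (use assms in auto)
  then show ?thesis by simp
qed

lemma Con_sel [simp]: "carrier (Con L A) = {\<theta>. congruence L A \<theta>}" "le (Con L A) = (\<subseteq>)"
  "eq (Con L A) = (=)"
  by (simp_all add: Con_def)

lemma Con_complete_lattice:
  assumes "ualgebra L A"
  shows "complete_lattice (Con L A)"
proof -
  interpret partial_order "Con L A"
    by unfold_locales auto
  show ?thesis
  proof (rule complete_lattice_criterion1)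
    show "\<exists>g. greatest (Con L A) g (carrier (Con L A))"
      by (rule exI[of _ "carrier A \<times> carrier A"])
        (auto simp: greatest_def congruence_full[OF assms] dest: congruenceD(1))
  next
    fix S assume "S \<subseteq> carrier (Con L A)" "S \<noteq> {}"
    then show "\<exists>i. greatest (Con L A) i (Lower (Con L A) S)"
      by (intro exI[of _ "\<Inter>S"]) (auto simp: greatest_def Lower_def intro!: congruence_Inter)
  qed
qed

lemma Theta_least:
  assumes "ualgebra L A" "c \<in> carrier A" "d \<in> carrier A"
  shows "least (Con L A) (Theta L A c d) {\<theta> \<in> carrier (Con L A). (c, d) \<in> \<theta>}"
proof -
  have "congruence L A (Theta L A c d)"
    unfolding Theta_def
  proof (rule congruence_Inter)
    show "{\<theta>. congruence L A \<theta> \<and> (c, d) \<in> \<theta>} \<noteq> {}"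
      using congruence_full[OF assms(1)] assms(2,3) by blast
  qed blast
  then show ?thesis unfolding least_def Theta_def by auto
qed

lemma Theta_eq_iff:
  assumes "ualgebra L A" "c \<in> carrier A" "a \<in> carrier A" "b \<in> carrier A"
  shows "Theta L A c a = Theta L A c b \<longleftrightarrow>
    (\<forall>\<theta>. congruence L A \<theta> \<longrightarrow> (c, a) \<in> \<theta> \<longleftrightarrow> (c, b) \<in> \<theta>)"
proof
  assume "Theta L A c a = Theta L A c b"
  then show "\<forall>\<theta>. congruence L A \<theta> \<longrightarrow> (c, a) \<in> \<theta> \<longleftrightarrow> (c, b) \<in> \<theta>"
    using Theta_least[OF assms(1,2,3)] Theta_least[OF assms(1,2,4)]
    unfolding least_def by auto
qed (auto simp: Theta_def)

lemma Con_meet: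
  assumes "ualgebra L A" "congruence L A \<alpha>" "congruence L A \<beta>"
  shows "\<alpha> \<sqinter>\<^bsub>Con L A\<^esub> \<beta> = \<alpha> \<inter> \<beta>"
proof -
  interpret complete_lattice "Con L A" by (rule Con_complete_lattice[OF assms(1)])
  have "congruence L A (\<alpha> \<inter> \<beta>)" by (rule congruence_Int[OF assms(2,3)])
  then show ?thesis
    using meet_left[of \<alpha> \<beta>] meet_right[of \<alpha> \<beta>] meet_le[of "\<alpha> \<inter> \<beta>" \<alpha> \<beta>] assms by auto
qed

lemma Con_join:
  assumes "ualgebra L A" "congruence L A \<alpha>" "congruence L A \<beta>"
  shows "congruence L A (\<alpha> \<squnion>\<^bsub>Con L A\<^esub> \<beta>)" "\<alpha> \<subseteq> \<alpha> \<squnion>\<^bsub>Con L A\<^esub> \<beta>" "\<beta> \<subseteq> \<alpha> \<squnion>\<^bsub>Con L A\<^esub> \<beta>"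
    and "congruence L A \<delta> \<Longrightarrow> \<alpha> \<subseteq> \<delta> \<Longrightarrow> \<beta> \<subseteq> \<delta> \<Longrightarrow> \<alpha> \<squnion>\<^bsub>Con L A\<^esub> \<beta> \<subseteq> \<delta>"
proof -
  interpret complete_lattice "Con L A" by (rule Con_complete_lattice[OF assms(1)])
  show "congruence L A (\<alpha> \<squnion>\<^bsub>Con L A\<^esub> \<beta>)" "\<alpha> \<subseteq> \<alpha> \<squnion>\<^bsub>Con L A\<^esub> \<beta>" "\<beta> \<subseteq> \<alpha> \<squnion>\<^bsub>Con L A\<^esub> \<beta>"
    using join_closed[of \<alpha> \<beta>] join_left[of \<alpha> \<beta>] join_right[of \<alpha> \<beta>] assms by simp_all
  show "\<alpha> \<squnion>\<^bsub>Con L A\<^esub> \<beta> \<subseteq> \<delta>" if "congruence L A \<delta>" "\<alpha> \<subseteq> \<delta>" "\<beta> \<subseteq> \<delta>"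
    using join_le[where x = \<alpha> and y = \<beta> and z = \<delta>] that assms by simp
qed

definition pullback :: "('f, 'a) ualg \<Rightarrow> ('a \<Rightarrow> 'b) \<Rightarrow> ('b \<times> 'b) set \<Rightarrow> ('a \<times> 'a) set" where
  "pullback A h \<theta> = {(x, y). x \<in> carrier A \<and> y \<in> carrier A \<and> (h x, h y) \<in> \<theta>}"

lemma congruence_pullback:
  assumes "ualgebra L A" "alg_hom L A B h" "congruence L B \<theta>"
  shows "congruence L A (pullback A h \<theta>)"
proof (rule congruenceI)
  fix f xs ys
  assume L: "L f = Some (length xs)" and r: "list_all2 (\<lambda>x y. (x, y) \<in> pullback A h \<theta>) xs ys"
  have c: "set xs \<subseteq> carrier A \<and> set ys \<subseteq> carrier A"
    using r by (rule list_all2_carrier) (auto simp: pullback_def)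
  have l: "length xs = length ys" using r by (rule list_all2_lengthD)
  have "list_all2 (\<lambda>x y. (x, y) \<in> \<theta>) (map h xs) (map h ys)"
    unfolding list_all2_map1 list_all2_map2
    by (rule list_all2_mono[OF r]) (auto simp: pullback_def)
  then have "(interp B f (map h xs), interp B f (map h ys)) \<in> \<theta>"
    using congruenceD(5)[OF assms(3), of f "map h xs"] L by simp
  then show "(interp A f xs, interp A f ys) \<in> pullback A h \<theta>"
    using c l L assms(1,2) by (auto simp: pullback_def ualgebra_def alg_hom_def)
next
  fix x assume "x \<in> carrier A"
  then show "(x, x) \<in> pullback A h \<theta>"
    using assms(2) congruenceD(2)[OF assms(3)] by (auto simp: pullback_def alg_hom_def)
qed (auto simp: pullback_def dest: congruenceD(3,4)[OF assms(3)])

lemma eval_tm_hom: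
  assumes "ualgebra L A" "alg_hom L A B h" "range \<rho> \<subseteq> carrier A" "wf_tm L t"
  shows "eval_tm A \<rho> t \<in> carrier A \<and> h (eval_tm A \<rho> t) = eval_tm B (h \<circ> \<rho>) t"
  using assms(4)
proof (induction t)
  case (App f ts)
  then have "L f = Some (length (map (eval_tm A \<rho>) ts))" "set (map (eval_tm A \<rho>) ts) \<subseteq> carrier A"
    "map h (map (eval_tm A \<rho>) ts) = map (eval_tm B (h \<circ> \<rho>)) ts"
    by (auto simp: comp_def)
  then show ?case using assms(1,2) unfolding alg_hom_def ualgebra_def
    by (metis eval_tm.simps(2))
qed (use assms(3) in auto)

lemma const_val_eq:
  assumes "ualgebra L A" "constant_term L A t" "range \<rho> \<subseteq> carrier A"
  shows "eval_tm A \<rho> t = const_val A t"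
proof -
  obtain c where c: "\<forall>\<rho>. range \<rho> \<subseteq> carrier A \<longrightarrow> eval_tm A \<rho> t = c"
    using assms(2) unfolding constant_term_def by blast
  have "const_val A t = c"
    unfolding const_val_def by (rule the_equality) (use c assms(3) in auto)
  then show ?thesis using c assms(3) by simp
qed

lemma ex_valuation:
  assumes "ualgebra L A"
  obtains \<rho> :: "nat \<Rightarrow> 'a" where "range \<rho> \<subseteq> carrier (A :: ('f, 'a) ualg)"
proof -
  obtain x where "x \<in> carrier A" using assms by (auto simp: ualgebra_def)
  then show ?thesis using that[of "\<lambda>_. x"] by auto
qed

lemma constant_term_image:
  fixes A :: "('f, 'a) ualg" and B :: "('f, 'b) ualg"
  assumes "ualgebra L A" "ualgebra L B" "alg_hom L A B h" "h ` carrier A = carrier B"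
    "constant_term L A t"
  shows "constant_term L B t \<and> const_val A t \<in> carrier A \<and> const_val B t = h (const_val A t)"
proof -
  have wf: "wf_tm L t" using assms(5) by (simp add: constant_term_def)
  have *: "eval_tm B \<rho> t = h (const_val A t)" if \<rho>: "range \<rho> \<subseteq> carrier B" for \<rho>
  proof -
    define \<sigma> where "\<sigma> = (\<lambda>i. SOME x. x \<in> carrier A \<and> h x = \<rho> i)"
    have "\<sigma> i \<in> carrier A \<and> h (\<sigma> i) = \<rho> i" for i
    proof -
      have "\<rho> i \<in> h ` carrier A" unfolding assms(4) using \<rho> by (rule subsetD) (rule rangeI)
      then have "\<exists>x. x \<in> carrier A \<and> h x = \<rho> i" by (elim imageE) (metis)
      then show ?thesis unfolding \<sigma>_def by (rule someI_ex)
    qed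
    then have s: "range \<sigma> \<subseteq> carrier A" "h \<circ> \<sigma> = \<rho>" by (blast, simp add: fun_eq_iff)
    show ?thesis
      using eval_tm_hom[OF assms(1,3) s(1) wf] const_val_eq[OF assms(1,5) s(1)] s(2) by metis
  qed
  then have ct: "constant_term L B t" using wf unfolding constant_term_def by blast
  obtain \<rho> :: "nat \<Rightarrow> 'b" where "range \<rho> \<subseteq> carrier B" using ex_valuation[OF assms(2)] .
  then have "const_val B t = h (const_val A t)"
    using * const_val_eq[OF assms(2) ct] by simp
  moreover obtain \<sigma> :: "nat \<Rightarrow> 'a" where \<sigma>: "range \<sigma> \<subseteq> carrier A"
    using ex_valuation[OF assms(1)] .
  have "const_val A t \<in> carrier A"
    using const_val_eq[OF assms(1,5) \<sigma>] eval_tm_hom[OF assms(1,3) \<sigma> wf] by simp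
  ultimately show ?thesis using ct by blast
qed

lemma alg_hom_comp:
  assumes "alg_hom L A B g" "alg_hom L B C h"
  shows "alg_hom L A C (h \<circ> g)"
  unfolding alg_hom_def
proof (intro conjI allI impI)
  fix f xs assume x: "L f = Some (length xs)" "set xs \<subseteq> carrier A"
  then have "set (map g xs) \<subseteq> carrier B" "L f = Some (length (map g xs))"
    using assms(1) by (auto simp: alg_hom_def)
  then show "(h \<circ> g) (interp A f xs) = interp C f (map (h \<circ> g) xs)"
    using assms x unfolding alg_hom_def by (metis comp_apply map_map)
qed (use assms in \<open>auto simp: alg_hom_def image_subset_iff\<close>)

lemma alg_hom_transport:
  assumes "ualgebra L B" "inj_on k (carrier B)"
    and g: "\<forall>x \<in> carrier B. g (k x) = x"
    and D: "D = \<lparr>carrier = k ` carrier B, interp = \<lambda>f Xs. k (interp B f (map g Xs))\<rparr>"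
  shows "ualgebra L D" "alg_hom L B D k" "alg_hom L D B g"
proof -
  have m: "map (g \<circ> k) xs = xs" if "set xs \<subseteq> carrier B" for xs
    using that g by (intro map_idI) auto
  have s: "set (map g Xs) \<subseteq> carrier B" if "set Xs \<subseteq> k ` carrier B" for Xs
    using that g by auto
  show "ualgebra L D"
    using assms(1) s unfolding ualgebra_def D by (auto simp del: set_map)
  show "alg_hom L B D k"
    using m unfolding alg_hom_def D by auto
  show "alg_hom L D B g"
    using assms(1) s g unfolding alg_hom_def D ualgebra_def by (auto simp del: set_map)
qed

theorem strongly_fregean_all:
  fixes A :: "('f, 'a) ualg" and B :: "('f, 'b) ualg"
  assumes "ualgebra L A" "constant_term L A one" "strongly_fregean L A one"
    and "homomorphic_image L A B"
  shows "fregean L B one"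
proof -
  have B: "ualgebra L B" using assms(4) by (simp add: homomorphic_image_def)
  obtain h where h: "alg_hom L A B h" "h ` carrier A = carrier B"
    using assms(4) by (auto simp: homomorphic_image_def)
  define k where "k b = {x \<in> carrier A. h x = b}" for b
  define g where "g X = h (SOME x. x \<in> X)" for X
  have gk: "g (k b) = b" if "b \<in> carrier B" for b
  proof -
    have "\<exists>x. x \<in> k b" using that unfolding k_def h(2)[symmetric] by blast
    then have "(SOME x. x \<in> k b) \<in> k b" by (rule someI_ex)
    then show ?thesis by (simp add: g_def k_def)
  qed
  then have inj: "inj_on k (carrier B)" by (rule inj_on_inverseI)
  define D where "D = \<lparr>carrier = k ` carrier B, interp = \<lambda>f Xs. k (interp B f (map g Xs))\<rparr>"
  have "\<forall>b \<in> carrier B. g (k b) = b" using gk by blast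
  note t = alg_hom_transport[OF B inj this D_def]
  have kD: "k ` carrier B = carrier D" by (simp add: D_def)
  have "alg_hom L A D (k \<circ> h)" "(k \<circ> h) ` carrier A = carrier D"
    unfolding image_comp[symmetric] h(2) kD by (rule alg_hom_comp[OF h(1) t(2)]) (rule refl)
  then have "homomorphic_image L A D" using t(1) unfolding homomorphic_image_def by blast
  then have frD: "fregean L D one" using assms(3) by (simp add: strongly_fregean_def)
  have cB: "constant_term L B one" using constant_term_image[OF assms(1) B h assms(2)] by simp
  have oB: "const_val B one \<in> carrier B" and oD: "const_val D one = k (const_val B one)"
    using constant_term_image[OF B t(1,2) kD cB] by auto
  then have oD': "const_val D one \<in> carrier D" using kD by auto
  have "congruence_orderable L B one"
    unfolding congruence_orderable_def
  proof (intro ballI impI)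
    fix a b assume ab: "a \<in> carrier B" "b \<in> carrier B"
      and "Theta L B (const_val B one) a = Theta L B (const_val B one) b"
    then have e: "(const_val B one, a) \<in> \<theta> \<longleftrightarrow> (const_val B one, b) \<in> \<theta>" if "congruence L B \<theta>" for \<theta>
      using that Theta_eq_iff[OF B oB] by blast
    have kab: "k a \<in> carrier D" "k b \<in> carrier D" using ab kD by auto
    have "Theta L D (const_val D one) (k a) = Theta L D (const_val D one) (k b)"
      unfolding Theta_eq_iff[OF t(1) oD' kab]
    proof (intro allI impI)
      fix \<theta> assume "congruence L D \<theta>"
      from e[OF congruence_pullback[OF B t(2) this]]
      show "(const_val D one, k a) \<in> \<theta> \<longleftrightarrow> (const_val D one, k b) \<in> \<theta>"
        using ab oB oD by (simp add: pullback_def)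
    qed
    then have "k a = k b" using frD kab by (simp add: fregean_def congruence_orderable_def)
    then show "a = b" using inj ab by (simp add: inj_on_def)
  qed
  moreover have "one_regular L B one"
    unfolding one_regular_def
  proof (intro ballI impI)
    fix \<alpha> \<beta> assume "\<alpha> \<in> carrier (Con L B)" "\<beta> \<in> carrier (Con L B)"
      and e: "\<alpha> `` {const_val B one} = \<beta> `` {const_val B one}"
    then have c: "congruence L B \<alpha>" "congruence L B \<beta>" by auto
    have "g (const_val D one) = const_val B one" using oB oD gk by simp
    then have "pullback D g \<alpha> `` {const_val D one} = pullback D g \<beta> `` {const_val D one}"
      using e by (auto simp: pullback_def)
    then have pe: "pullback D g \<alpha> = pullback D g \<beta>"
      using frD congruence_pullback[OF t(1,3)] c by (simp add: fregean_def one_regular_def)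
    have "(x, y) \<in> \<alpha> \<longleftrightarrow> (x, y) \<in> \<beta>" if "x \<in> carrier B" "y \<in> carrier B" for x y
    proof -
      have "(k x, k y) \<in> pullback D g \<alpha> \<longleftrightarrow> (k x, k y) \<in> pullback D g \<beta>" by (simp add: pe)
      then show ?thesis using that gk kD by (auto simp: pullback_def)
    qed
    then show "\<alpha> = \<beta>" using congruenceD(1)[OF c(1)] congruenceD(1)[OF c(2)] by blast
  qed
  ultimately show ?thesis by (simp add: fregean_def)
qed

lemma congruence_trancl_Un:
  assumes A: "ualgebra L A" and c: "congruence L A \<alpha>" "congruence L A \<beta>"
  shows "congruence L A ((\<alpha> \<union> \<beta>)\<^sup>+)"
proof -
  let ?R = "(\<alpha> \<union> \<beta>)\<^sup>+"
  have sub: "?R \<subseteq> carrier A \<times> carrier A"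
    using c by (intro trancl_subset_Sigma) (auto dest: congruenceD(1))
  have refl: "(x, x) \<in> ?R" if "x \<in> carrier A" for x
    using congruenceD(2)[OF c(1) that] by blast
  have "sym (\<alpha> \<union> \<beta>)" using c by (auto intro!: symI dest: congruenceD(3))
  then have sym: "sym ?R" by (rule sym_trancl)
  have trans: "(x, z) \<in> ?R" if "(x, y) \<in> ?R" "(y, z) \<in> ?R" for x y z
    using that by (rule trancl_trans)
  have one: "(interp A f (us @ x # vs), interp A f (us @ y # vs)) \<in> ?R"
    if xy: "(x, y) \<in> ?R" and f: "L f = Some (length us + Suc (length vs))"
      and s: "set us \<subseteq> carrier A" "set vs \<subseteq> carrier A" for f us vs x y
  proof -
    have stp: "(interp A f (us @ x # vs), interp A f (us @ y # vs)) \<in> \<alpha> \<union> \<beta>"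
      if "(x, y) \<in> \<alpha> \<union> \<beta>" for x y
    proof -
      have r: "list_all2 (\<lambda>x y. (x, y) \<in> \<theta>) (us @ x # vs) (us @ y # vs)"
        if "congruence L A \<theta>" "(x, y) \<in> \<theta>" for \<theta>
      proof -
        have "list_all2 (\<lambda>x y. (x, y) \<in> \<theta>) ws ws" if "set ws \<subseteq> carrier A" for ws
          unfolding list_all2_same using that congruenceD(2)[OF \<open>congruence L A \<theta>\<close>] by blast
        with s that(2) show ?thesis by (intro list_all2_appendI) auto
      qed
      have "length (us @ x # vs) = length us + Suc (length vs)" by simp
      then show ?thesis
        using that r c congruenceD(5)[of L A _ f "us @ x # vs" "us @ y # vs"] f
        by (auto simp del: list_all2_append1 list_all2_append2)
    qed
    from xy show ?thesis
    proof (induction rule: trancl_induct)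
      case (base y) then show ?case using stp by (blast intro: r_into_trancl)
    next
      case (step y z)
      from step.IH stp[OF step.hyps(2)] show ?case by (rule trancl_into_trancl)
    qed
  qed
  have many: "(interp A f (us @ xs), interp A f (us @ ys)) \<in> ?R"
    if "list_all2 (\<lambda>x y. (x, y) \<in> ?R) xs ys" "L f = Some (length us + length xs)"
      "set us \<subseteq> carrier A" for f us xs ys
    using that
  proof (induction arbitrary: us rule: list_all2_induct)
    case Nil
    then show ?case using A refl by (auto simp: ualgebra_def)
  next
    case (Cons x xs y ys)
    have xy: "x \<in> carrier A" "y \<in> carrier A" using Cons.hyps(1) sub by auto
    have xs: "set xs \<subseteq> carrier A" using list_all2_carrier[OF Cons.hyps(2) sub] by simp
    have "(interp A f (us @ x # xs), interp A f (us @ y # xs)) \<in> ?R"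
      using one[OF Cons.hyps(1)] Cons.prems xs by simp
    moreover have "(interp A f ((us @ [y]) @ xs), interp A f ((us @ [y]) @ ys)) \<in> ?R"
      using Cons.IH[of "us @ [y]"] Cons.prems xy by simp
    ultimately show ?case using trans by simp
  qed
  show ?thesis
  proof (rule congruenceI)
    fix f xs ys
    assume "L f = Some (length xs)" "list_all2 (\<lambda>x y. (x, y) \<in> ?R) xs ys"
    then show "(interp A f xs, interp A f ys) \<in> ?R" using many[of xs ys f "[]"] by simp
  qed (fact sub, erule refl, erule symD[OF sym], erule (1) trans)
qed

lemma trancl_path:
  assumes "(x, y) \<in> R\<^sup>+"
  shows "\<exists>F. finite F \<and> x \<in> F \<and> y \<in> F \<and> F \<subseteq> Field R \<and> (x, y) \<in> (R \<inter> F \<times> F)\<^sup>+"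
  using assms
proof (induction rule: trancl_induct)
  case (base y)
  then show ?case by (intro exI[of _ "{x, y}"]) (auto simp: Field_def)
next
  case (step y z)
  then obtain F where F: "finite F" "x \<in> F" "y \<in> F" "F \<subseteq> Field R" "(x, y) \<in> (R \<inter> F \<times> F)\<^sup>+" by blast
  have "(x, y) \<in> (R \<inter> insert z F \<times> insert z F)\<^sup>+"
    by (rule trancl_mono[OF F(5)]) auto
  moreover have "(y, z) \<in> R \<inter> insert z F \<times> insert z F" using step F by auto
  ultimately have "(x, z) \<in> (R \<inter> insert z F \<times> insert z F)\<^sup>+" by (rule trancl_into_trancl)
  then show ?case using F step(2) by (intro exI[of _ "insert z F"]) (auto simp: Field_def)
qed

theorem variety_modular_all:
  fixes A :: "('f, 'a) ualg" and B :: "('f, 'b) ualg"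
  assumes V: "variety_congruence_modular L A" and BV: "in_variety L A B"
  shows "modular_lattice (Con L B)"
proof -
  have B: "ualgebra L B" using BV by (simp add: in_variety_def)
  interpret complete_lattice "Con L B" by (rule Con_complete_lattice[OF B])
  have main: "(x, y) \<in> \<alpha> \<squnion>\<^bsub>Con L B\<^esub> (\<beta> \<inter> \<gamma>)"
    if c: "congruence L B \<alpha>" "congruence L B \<beta>" "congruence L B \<gamma>" "\<alpha> \<subseteq> \<gamma>"
      and xy: "(x, y) \<in> \<alpha> \<squnion>\<^bsub>Con L B\<^esub> \<beta>" "(x, y) \<in> \<gamma>" for \<alpha> \<beta> \<gamma> x y
  proof -
    have "\<alpha> \<squnion>\<^bsub>Con L B\<^esub> \<beta> \<subseteq> (\<alpha> \<union> \<beta>)\<^sup>+"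
      by (rule Con_join(4)[OF B c(1,2) congruence_trancl_Un[OF B c(1,2)]]) auto
    then obtain F where F: "finite F" "x \<in> F" "y \<in> F" "F \<subseteq> Field (\<alpha> \<union> \<beta>)"
      "(x, y) \<in> ((\<alpha> \<union> \<beta>) \<inter> F \<times> F)\<^sup>+"
      using xy(1) trancl_path[of x y "\<alpha> \<union> \<beta>"] by blast
    have FB: "F \<subseteq> carrier B"
      using F(4) congruenceD(1)[OF c(1)] congruenceD(1)[OF c(2)] by (auto simp: Field_def)
    define \<rho> where "\<rho> = from_nat_into F"
    have \<rho>: "range \<rho> = F"
      using F(1,2) unfolding \<rho>_def by (intro range_from_nat_into) (auto intro: countable_finite)
    then have \<rho>B: "range \<rho> \<subseteq> carrier B" using FB by simp
    define T where "T = {t :: ('f, nat) tm. wf_tm L t}"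
    define S where "S = B\<lparr>carrier := eval_tm B \<rho> ` T\<rparr>"
    have id: "alg_hom L B B id" by (auto simp: alg_hom_def)
    have TB: "eval_tm B \<rho> t \<in> carrier B" if "t \<in> T" for t
      using eval_tm_hom[OF B id \<rho>B] that by (simp add: T_def)
    have S: "ualgebra L S"
      unfolding ualgebra_def
    proof (intro conjI allI impI)
      have "Var 0 \<in> T" by (simp add: T_def)
      then show "carrier S \<noteq> {}" by (auto simp: S_def)
      fix f xs assume f: "L f = Some (length xs)" and "set xs \<subseteq> carrier S"
      then have "xs \<in> lists (eval_tm B \<rho> ` T)" by (auto simp: S_def)
      then obtain ts where ts: "set ts \<subseteq> T" "xs = map (eval_tm B \<rho>) ts"
        by (auto simp: lists_image)
      then have "App f ts \<in> T" "interp B f xs = eval_tm B \<rho> (App f ts)"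
        using f by (auto simp: T_def)
      then have "interp B f xs \<in> eval_tm B \<rho> ` T" by blast
      then show "interp S f xs \<in> carrier S" by (simp add: S_def)
    qed
    have SB: "alg_hom L S B id" using TB by (auto simp: alg_hom_def S_def)
    define k where "k b = {t \<in> T. eval_tm B \<rho> t = b}" for b
    define g where "g X = eval_tm B \<rho> (SOME t. t \<in> X)" for X
    have gk: "g (k b) = b" if "b \<in> carrier S" for b
    proof -
      have "\<exists>t. t \<in> k b" using that unfolding k_def S_def by auto
      then have "(SOME t. t \<in> k b) \<in> k b" by (rule someI_ex)
      then show ?thesis by (simp add: g_def k_def)
    qed
    then have inj: "inj_on k (carrier S)" by (rule inj_on_inverseI)
    define D where "D = \<lparr>carrier = k ` carrier S, interp = \<lambda>f Xs. k (interp S f (map g Xs))\<rparr>"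
    have "\<forall>b \<in> carrier S. g (k b) = b" using gk by blast
    note t = alg_hom_transport[OF S inj this D_def]
    have kD: "k ` carrier S = carrier D" by (simp add: D_def)
    have DB: "alg_hom L D B g" using alg_hom_comp[OF t(3) SB] by simp
    have injg: "inj_on g (carrier D)" using gk by (auto simp: D_def inj_on_def)
    have DV: "in_variety L A D"
      unfolding in_variety_def
    proof (intro conjI allI impI)
      fix s u assume w: "wf_tm L s" "wf_tm L u" and "satisfies A s u"
      then have sB: "satisfies B s u" using BV by (simp add: in_variety_def)
      show "satisfies D s u"
        unfolding satisfies_def
      proof (intro allI impI)
        fix \<sigma> :: "nat \<Rightarrow> ('f, nat) tm set" assume \<sigma>: "range \<sigma> \<subseteq> carrier D"
        then have "range (g \<circ> \<sigma>) \<subseteq> carrier B" using DB by (auto simp: alg_hom_def)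
        then have "eval_tm B (g \<circ> \<sigma>) s = eval_tm B (g \<circ> \<sigma>) u" using sB by (simp add: satisfies_def)
        then show "eval_tm D \<sigma> s = eval_tm D \<sigma> u"
          using eval_tm_hom[OF t(1) DB \<sigma>] w injg by (metis inj_onD)
      qed
    qed (rule t(1))
    let ?p = "pullback D g"
    note pc = congruence_pullback[OF t(1) DB]
    have mod: "?p \<alpha> \<squnion>\<^bsub>Con L D\<^esub> (?p \<beta> \<inter> ?p \<gamma>) = (?p \<alpha> \<squnion>\<^bsub>Con L D\<^esub> ?p \<beta>) \<inter> ?p \<gamma>"
    proof -
      have "modular_lattice (Con L D)" using V DV by (simp add: variety_congruence_modular_def)
      moreover have "?p \<alpha> \<subseteq> ?p \<gamma>" using c(4) by (auto simp: pullback_def)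
      ultimately have "?p \<alpha> \<squnion>\<^bsub>Con L D\<^esub> (?p \<beta> \<sqinter>\<^bsub>Con L D\<^esub> ?p \<gamma>)
          = (?p \<alpha> \<squnion>\<^bsub>Con L D\<^esub> ?p \<beta>) \<sqinter>\<^bsub>Con L D\<^esub> ?p \<gamma>"
        using pc c(1-3) by (simp add: modular_lattice_def)
      moreover have "congruence L D (?p \<alpha> \<squnion>\<^bsub>Con L D\<^esub> ?p \<beta>)"
        by (rule Con_join(1)[OF t(1) pc[OF c(1)] pc[OF c(2)]])
      ultimately show ?thesis using Con_meet[OF t(1)] pc c(1-3) by simp
    qed
    have FS: "F \<subseteq> carrier S"
    proof
      fix z assume "z \<in> F"
      then obtain i where "z = eval_tm B \<rho> (Var i)" using \<rho> by auto
      moreover have "Var i \<in> T" by (simp add: T_def)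
      ultimately have "z \<in> eval_tm B \<rho> ` T" by blast
      then show "z \<in> carrier S" by (simp add: S_def)
    qed
    let ?J = "?p \<alpha> \<squnion>\<^bsub>Con L D\<^esub> ?p \<beta>"
    have J: "congruence L D ?J" "?p \<alpha> \<subseteq> ?J" "?p \<beta> \<subseteq> ?J"
      by (rule Con_join[OF t(1) pc[OF c(1)] pc[OF c(2)]])+
    have stepJ: "(k u, k v) \<in> ?J" if "(u, v) \<in> (\<alpha> \<union> \<beta>) \<inter> F \<times> F" for u v
    proof -
      have "u \<in> carrier S" "v \<in> carrier S" using that FS by auto
      then have "(k u, k v) \<in> ?p \<alpha> \<union> ?p \<beta>" using that gk kD by (auto simp: pullback_def)
      then show ?thesis using J by blast
    qed
    have "(k x, k y) \<in> ?J"
      using F(5)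
    proof (induction rule: trancl_induct)
      case (base y) then show ?case by (rule stepJ)
    next
      case (step y z) then show ?case using stepJ congruenceD(4)[OF J(1)] by blast
    qed
    moreover have xyS: "x \<in> carrier S" "y \<in> carrier S" using F FS by auto
    then have "(k x, k y) \<in> ?p \<gamma>" using xy(2) gk kD by (auto simp: pullback_def)
    ultimately have *: "(k x, k y) \<in> ?p \<alpha> \<squnion>\<^bsub>Con L D\<^esub> (?p \<beta> \<inter> ?p \<gamma>)" using mod by blast
    have bg: "congruence L B (\<beta> \<inter> \<gamma>)" "congruence L D (?p \<beta> \<inter> ?p \<gamma>)"
      by (intro congruence_Int pc c)+
    let ?K = "\<alpha> \<squnion>\<^bsub>Con L B\<^esub> (\<beta> \<inter> \<gamma>)"
    have K: "congruence L B ?K" "\<alpha> \<subseteq> ?K" "\<beta> \<inter> \<gamma> \<subseteq> ?K"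
      by (rule Con_join[OF B c(1) bg(1)])+
    have "?p \<alpha> \<subseteq> ?p ?K" "?p \<beta> \<inter> ?p \<gamma> \<subseteq> ?p ?K" using K by (auto simp: pullback_def)
    then have "?p \<alpha> \<squnion>\<^bsub>Con L D\<^esub> (?p \<beta> \<inter> ?p \<gamma>) \<subseteq> ?p ?K"
      by (rule Con_join(4)[OF t(1) pc[OF c(1)] bg(2) pc[OF K(1)]])
    with * have "(g (k x), g (k y)) \<in> ?K" by (auto simp: pullback_def)
    then show ?thesis using gk xyS by simp
  qed
  have "\<alpha> \<squnion>\<^bsub>Con L B\<^esub> (\<beta> \<sqinter>\<^bsub>Con L B\<^esub> \<gamma>) = (\<alpha> \<squnion>\<^bsub>Con L B\<^esub> \<beta>) \<sqinter>\<^bsub>Con L B\<^esub> \<gamma>"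
    if c: "congruence L B \<alpha>" "congruence L B \<beta>" "congruence L B \<gamma>" "\<alpha> \<subseteq> \<gamma>" for \<alpha> \<beta> \<gamma>
  proof -
    have bg: "congruence L B (\<beta> \<inter> \<gamma>)" by (rule congruence_Int[OF c(2,3)])
    have J: "congruence L B (\<alpha> \<squnion>\<^bsub>Con L B\<^esub> \<beta>)" "\<alpha> \<subseteq> \<alpha> \<squnion>\<^bsub>Con L B\<^esub> \<beta>" "\<beta> \<subseteq> \<alpha> \<squnion>\<^bsub>Con L B\<^esub> \<beta>"
      by (rule Con_join[OF B c(1,2)])+
    have "congruence L B ((\<alpha> \<squnion>\<^bsub>Con L B\<^esub> \<beta>) \<inter> \<gamma>)"
      by (rule congruence_Int[OF J(1) c(3)])
    then have "\<alpha> \<squnion>\<^bsub>Con L B\<^esub> (\<beta> \<inter> \<gamma>) \<subseteq> (\<alpha> \<squnion>\<^bsub>Con L B\<^esub> \<beta>) \<inter> \<gamma>"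
      by (rule Con_join(4)[OF B c(1) bg]) (use J c(4) in blast)+
    moreover have "(\<alpha> \<squnion>\<^bsub>Con L B\<^esub> \<beta>) \<inter> \<gamma> \<subseteq> \<alpha> \<squnion>\<^bsub>Con L B\<^esub> (\<beta> \<inter> \<gamma>)"
      using main[OF c] by auto
    ultimately show ?thesis using Con_meet[OF B] c J by auto
  qed
  then show ?thesis
    unfolding modular_lattice_def using lattice_axioms by auto
qed


end

theory Submission
  imports Defs
begin

text \<open>
  Since \<open>e\<close> is a principal congruence term, a congruence contains \<open>(1, e(a, b))\<close> exactly when it
  contains \<open>(a, b)\<close>.  The theorem therefore says that a completely meet irreducible \<open>\<mu>\<close> contains
  \<open>(a, b)\<close> if and only if no completely meet irreducible \<open>\<phi> \<ge> \<mu>\<close> separates \<open>a\<close> from \<open>b\<close>, in the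
  sense that it contains exactly one of \<open>(1, a)\<close> and \<open>(1, b)\<close>.

  If \<open>\<mu>\<close> contains \<open>(a, b)\<close>, then so does every \<open>\<phi> \<ge> \<mu>\<close>, and transitivity excludes separation.
  Conversely, suppose that \<open>(a, b) \<notin> \<mu>\<close>.  The quotient of \<open>A\<close> by \<open>\<mu>\<close> is a homomorphic image
  of \<open>A\<close>, hence congruence orderable, so some congruence \<open>\<theta> \<ge> \<mu>\<close> of \<open>A\<close> separates \<open>a\<close>
  from \<open>b\<close> (lemma \<open>congruence_orderable_quotient\<close>), say \<open>(1, a) \<in> \<theta>\<close> and \<open>(1, b) \<notin> \<theta>\<close>.  By
  Zorn's lemma \<open>\<theta>\<close> extends to a congruence \<open>\<phi>\<close> maximal without \<open>(1, b)\<close>, which is completely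
  meet irreducible (lemma \<open>Cm_separation\<close>) and still separates \<open>a\<close> from \<open>b\<close>.
\<close>

lemma mem_congruence_iff_Theta:
  assumes "ualgebra L A" "c \<in> carrier A" "d \<in> carrier A" "congruence L A \<theta>"
  shows "(c, d) \<in> \<theta> \<longleftrightarrow> Theta L A c d \<subseteq> \<theta>"
  using Theta_least[OF assms(1-3)] assms(4) by (auto simp: least_def)

text \<open>
  The operations act on representatives picked by choice; on classes of a congruence the result
  does not depend on the choice.
\<close>

definition quotient_algebra :: "('f, 'a) ualg \<Rightarrow> ('a \<times> 'a) set \<Rightarrow> ('f, 'a set) ualg" where
  "quotient_algebra A \<mu> = \<lparr>carrier = carrier A // \<mu>,
     interp = \<lambda>f Xs. \<mu> `` {interp A f (map (\<lambda>X. SOME x. x \<in> X) Xs)}\<rparr>"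

lemma quotient_algebra:
  assumes A: "ualgebra L A" and \<mu>: "congruence L A \<mu>"
  shows "ualgebra L (quotient_algebra A \<mu>)"
    and "alg_hom L A (quotient_algebra A \<mu>) (\<lambda>x. \<mu> `` {x})"
    and "(\<lambda>x. \<mu> `` {x}) ` carrier A = carrier (quotient_algebra A \<mu>)"
proof -
  have eqv: "equiv (carrier A) \<mu>" using \<mu> by (simp add: congruence_def)
  define r :: "'b set \<Rightarrow> 'b" where "r X = (SOME x. x \<in> X)" for X
  have r_class: "(x, r (\<mu> `` {x})) \<in> \<mu>" if "x \<in> carrier A" for x
  proof -
    have "x \<in> \<mu> `` {x}" using congruenceD(2)[OF \<mu> that] by simp
    then have "r (\<mu> `` {x}) \<in> \<mu> `` {x}" unfolding r_def by (rule someI)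
    then show ?thesis by simp
  qed
  have r_carrier: "r X \<in> carrier A" if "X \<in> carrier A // \<mu>" for X
    using that r_class congruenceD(1)[OF \<mu>] by (auto elim!: quotientE)
  have Q: "carrier (quotient_algebra A \<mu>) = carrier A // \<mu>"
    "interp (quotient_algebra A \<mu>) f Xs = \<mu> `` {interp A f (map r Xs)}" for f Xs
    by (simp_all add: quotient_algebra_def r_def[abs_def])
  show "ualgebra L (quotient_algebra A \<mu>)"
    unfolding ualgebra_def Q
  proof (intro conjI allI impI)
    show "carrier A // \<mu> \<noteq> {}" using A by (auto simp: ualgebra_def quotient_def)
    fix f Xs assume "L f = Some (length Xs)" "set Xs \<subseteq> carrier A // \<mu>"
    then have "L f = Some (length (map r Xs))" "set (map r Xs) \<subseteq> carrier A"
      using r_carrier by auto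
    then have "interp A f (map r Xs) \<in> carrier A" using A unfolding ualgebra_def by blast
    then show "\<mu> `` {interp A f (map r Xs)} \<in> carrier A // \<mu>" by (rule quotientI)
  qed
  show "alg_hom L A (quotient_algebra A \<mu>) (\<lambda>x. \<mu> `` {x})"
    unfolding alg_hom_def Q
  proof (intro conjI allI impI)
    show "(\<lambda>x. \<mu> `` {x}) ` carrier A \<subseteq> carrier A // \<mu>" by (auto intro: quotientI)
    fix f xs assume f: "L f = Some (length xs)" "set xs \<subseteq> carrier A"
    have "list_all2 (\<lambda>x y. (x, y) \<in> \<mu>) xs (map r (map (\<lambda>x. \<mu> `` {x}) xs))"
      unfolding map_map comp_def list.rel_map list_all2_same using f(2) r_class by blast
    then show "\<mu> `` {interp A f xs}
        = \<mu> `` {interp A f (map r (map (\<lambda>x. \<mu> `` {x}) xs))}"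
      by (intro equiv_class_eq[OF eqv] congruenceD(5)[OF \<mu> f(1)])
  qed
  show "(\<lambda>x. \<mu> `` {x}) ` carrier A = carrier (quotient_algebra A \<mu>)"
    unfolding Q by (auto simp: quotient_def)
qed

text \<open>
  Congruence orderability of a quotient, read in the algebra itself: congruences of the quotient
  pull back to congruences above \<open>\<mu>\<close>, so if none of the latter separates \<open>a\<close> from \<open>b\<close>, their
  classes generate the same principal congruence with \<open>1\<close> and must coincide.
\<close>

lemma congruence_orderable_quotient:
  assumes A: "ualgebra L A" and one: "constant_term L A one" and \<mu>: "congruence L A \<mu>"
    and ord: "congruence_orderable L (quotient_algebra A \<mu>) one"
    and ab: "a \<in> carrier A" "b \<in> carrier A"
    and same: "\<And>\<theta>. congruence L A \<theta> \<Longrightarrow> \<mu> \<subseteq> \<theta> \<Longrightarrow>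
      (const_val A one, a) \<in> \<theta> \<longleftrightarrow> (const_val A one, b) \<in> \<theta>"
  shows "(a, b) \<in> \<mu>"
proof -
  let ?B = "quotient_algebra A \<mu>" and ?h = "\<lambda>x. \<mu> `` {x}"
  note B = quotient_algebra[OF A \<mu>]
  have eqv: "equiv (carrier A) \<mu>" using \<mu> by (simp add: congruence_def)
  have o: "const_val A one \<in> carrier A" "const_val ?B one = ?h (const_val A one)"
    using constant_term_image[OF A B one] by simp_all
  have hB: "?h x \<in> carrier ?B" if "x \<in> carrier A" for x using B(3) that by blast
  have "Theta L ?B (const_val ?B one) (?h a) = Theta L ?B (const_val ?B one) (?h b)"
    unfolding o(2) Theta_eq_iff[OF B(1) hB[OF o(1)] hB[OF ab(1)] hB[OF ab(2)]]
  proof (intro allI impI)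
    fix \<theta> assume \<theta>: "congruence L ?B \<theta>"
    have "\<mu> \<subseteq> pullback A ?h \<theta>"
    proof (rule subrelI)
      fix x y assume xy: "(x, y) \<in> \<mu>"
      then have c: "x \<in> carrier A" "y \<in> carrier A" using congruenceD(1)[OF \<mu>] by auto
      have "?h x = ?h y" by (rule equiv_class_eq[OF eqv xy])
      then show "(x, y) \<in> pullback A ?h \<theta>"
        using c congruenceD(2)[OF \<theta> hB[OF c(2)]] by (simp add: pullback_def)
    qed
    from same[OF congruence_pullback[OF A B(2) \<theta>] this]
    show "(?h (const_val A one), ?h a) \<in> \<theta> \<longleftrightarrow> (?h (const_val A one), ?h b) \<in> \<theta>"
      using ab o(1) by (simp add: pullback_def)
  qed
  then have "?h a = ?h b" using ord hB ab by (simp add: congruence_orderable_def)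
  then show ?thesis using ab(2) by (rule eq_equiv_class[OF _ eqv])
qed

text \<open>
  Operations are finitary, so the finitely many related pairs of arguments in one application
  already lie in a single member of the chain.
\<close>

lemma list_all2_Union_chain:
  assumes "C \<noteq> {}" and chain: "\<And>X Y. X \<in> C \<Longrightarrow> Y \<in> C \<Longrightarrow> X \<subseteq> Y \<or> Y \<subseteq> X"
    and "list_all2 (\<lambda>x y. (x, y) \<in> \<Union>C) xs ys"
  shows "\<exists>X \<in> C. list_all2 (\<lambda>x y. (x, y) \<in> X) xs ys"
  using assms(3)
proof (induction rule: list_all2_induct)
  case Nil
  then show ?case using assms(1) by auto
next
  case (Cons x xs y ys)
  then obtain X Y where X: "X \<in> C" "(x, y) \<in> X"
    and Y: "Y \<in> C" "list_all2 (\<lambda>x y. (x, y) \<in> Y) xs ys" by blast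
  obtain Z where Z: "Z \<in> C" "X \<subseteq> Z" "Y \<subseteq> Z" using chain[OF X(1) Y(1)] X(1) Y(1) by blast
  have "list_all2 (\<lambda>x y. (x, y) \<in> Z) xs ys"
    by (rule list_all2_mono[OF Y(2)]) (use Z in blast)
  then show ?case using X Z by auto
qed

lemma congruence_Union_chain:
  assumes ne: "C \<noteq> {}" and con: "\<And>\<theta>. \<theta> \<in> C \<Longrightarrow> congruence L A \<theta>"
    and chain: "\<And>X Y. X \<in> C \<Longrightarrow> Y \<in> C \<Longrightarrow> X \<subseteq> Y \<or> Y \<subseteq> X"
  shows "congruence L A (\<Union>C)"
proof (rule congruenceI)
  show "\<Union>C \<subseteq> carrier A \<times> carrier A" using congruenceD(1)[OF con] by blast
  show "(x, x) \<in> \<Union>C" if "x \<in> carrier A" for x using ne congruenceD(2)[OF con that] by blast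
  show "(y, x) \<in> \<Union>C" if "(x, y) \<in> \<Union>C" for x y using that congruenceD(3)[OF con] by blast
  show "(x, z) \<in> \<Union>C" if xy: "(x, y) \<in> \<Union>C" and yz: "(y, z) \<in> \<Union>C" for x y z
  proof -
    obtain X Y where XY: "X \<in> C" "(x, y) \<in> X" "Y \<in> C" "(y, z) \<in> Y" using xy yz by blast
    then obtain Z where "Z \<in> C" "(x, y) \<in> Z" "(y, z) \<in> Z" using chain[of X Y] by blast
    then show ?thesis using congruenceD(4)[OF con] by blast
  qed
  fix f xs ys
  assume f: "L f = Some (length xs)" and r: "list_all2 (\<lambda>x y. (x, y) \<in> \<Union>C) xs ys"
  obtain X where "X \<in> C" "list_all2 (\<lambda>x y. (x, y) \<in> X) xs ys"
    using list_all2_Union_chain[OF ne chain r] by blast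
  then show "(interp A f xs, interp A f ys) \<in> \<Union>C" using congruenceD(5)[OF con f] by blast
qed

text \<open>
  A congruence maximal among those omitting \<open>(c, d)\<close> is completely meet irreducible: all
  strictly larger congruences contain \<open>(c, d)\<close>, hence so does any meet of them.
\<close>

lemma completely_meet_irreducible_if_maximal:
  assumes A: "ualgebra L A" and cd: "c \<in> carrier A" "d \<in> carrier A"
    and \<phi>: "congruence L A \<phi>" "(c, d) \<notin> \<phi>"
    and max: "\<And>\<psi>. congruence L A \<psi> \<Longrightarrow> \<phi> \<subset> \<psi> \<Longrightarrow> (c, d) \<in> \<psi>"
  shows "\<phi> \<in> Cm L A"
proof -
  interpret complete_lattice "Con L A" by (rule Con_complete_lattice[OF A])
  have "\<phi> \<in> S" if S: "S \<subseteq> carrier (Con L A)" and meet: "\<Sqinter>\<^bsub>Con L A\<^esub>S = \<phi>" for S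
  proof (rule ccontr)
    assume "\<phi> \<notin> S"
    have \<Theta>: "congruence L A (Theta L A c d)" using Theta_least[OF A cd] by (simp add: least_def)
    have "Theta L A c d \<subseteq> \<psi>" if \<psi>: "\<psi> \<in> S" for \<psi>
    proof -
      have con: "congruence L A \<psi>" using S \<psi> by auto
      have "\<phi> \<subseteq> \<psi>" using inf_lower[OF S \<psi>] meet by simp
      with \<open>\<phi> \<notin> S\<close> \<psi> have "(c, d) \<in> \<psi>" using max[OF con] by blast
      then show ?thesis using mem_congruence_iff_Theta[OF A cd con] by simp
    qed
    then have "Theta L A c d \<subseteq> \<phi>"
      using inf_greatest[OF S, of "Theta L A c d"] \<Theta> meet by simp
    then show False using mem_congruence_iff_Theta[OF A cd \<phi>(1)] \<phi>(2) by simp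
  qed
  then show ?thesis using \<phi>(1) by (simp add: Cm_def completely_meet_irreducible_def)
qed

lemma Cm_separation:
  assumes A: "ualgebra L A" and cd: "c \<in> carrier A" "d \<in> carrier A"
    and \<theta>: "congruence L A \<theta>" "(c, d) \<notin> \<theta>"
  obtains \<phi> where "\<phi> \<in> Cm L A" "\<theta> \<subseteq> \<phi>" "(c, d) \<notin> \<phi>"
proof -
  let ?F = "{\<psi>. congruence L A \<psi> \<and> \<theta> \<subseteq> \<psi> \<and> (c, d) \<notin> \<psi>}"
  have "\<exists>\<phi> \<in> ?F. \<forall>\<psi> \<in> ?F. \<phi> \<subseteq> \<psi> \<longrightarrow> \<psi> = \<phi>"
  proof (rule subset_Zorn_nonempty)
    show "?F \<noteq> {}" using \<theta> by blast
    fix C assume C: "C \<noteq> {}" "subset.chain ?F C"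
    then have "congruence L A (\<Union>C)"
      by (intro congruence_Union_chain) (auto simp: subset_chain_def)
    then show "\<Union>C \<in> ?F" using C by (auto simp: subset_chain_def)
  qed
  then obtain \<phi> where "\<phi> \<in> ?F" and max: "\<forall>\<psi> \<in> ?F. \<phi> \<subseteq> \<psi> \<longrightarrow> \<psi> = \<phi>" by (rule bexE)
  then have \<phi>: "congruence L A \<phi>" "\<theta> \<subseteq> \<phi>" "(c, d) \<notin> \<phi>" by simp_all
  have "(c, d) \<in> \<psi>" if "congruence L A \<psi>" "\<phi> \<subset> \<psi>" for \<psi>
  proof (rule ccontr)
    assume "(c, d) \<notin> \<psi>"
    then have "\<psi> \<in> ?F" using that \<phi>(2) by auto
    then show False using max that(2) by auto
  qed
  then have "\<phi> \<in> Cm L A" by (rule completely_meet_irreducible_if_maximal[OF A cd \<phi>(1,3)])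
  then show ?thesis by (rule that[OF _ \<phi>(2,3)])
qed

theorem corollary30:
  fixes L :: "'f \<rightharpoonup> nat"
    and A :: "('f, 'a) ualg"
    and one e :: "('f, nat) tm"
    and a b :: 'a
  assumes "ualgebra L A"
    and "constant_term L A one"
    and "strongly_fregean L A one"
    and "principal_congruence_term L A one e"
    and "a \<in> carrier A" and "b \<in> carrier A"
  shows "M L A one (binary_val A e a b) = equiv_Cm L A (M L A one a) (M L A one b)"
proof -
  note A = assms(1) and a = assms(5) and b = assms(6)
  let ?o = "const_val A one"
  have id: "alg_hom L A A id" by (auto simp: alg_hom_def)
  have o: "?o \<in> carrier A" using constant_term_image[OF A A id _ assms(2)] by simp
  have Cm_con: "congruence L A \<mu>" if "\<mu> \<in> Cm L A" for \<mu>
    using that by (simp add: Cm_def completely_meet_irreducible_def)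
  have e: "binary_val A e a b \<in> carrier A"
    unfolding binary_val_def using eval_tm_hom[OF A id, of "\<lambda>i. if i = 0 then a else b" e] a b assms(4)
    by (auto simp: principal_congruence_term_def)
  have principal: "(?o, binary_val A e a b) \<in> \<mu> \<longleftrightarrow> (a, b) \<in> \<mu>" if "congruence L A \<mu>" for \<mu>
    using mem_congruence_iff_Theta[OF A o e that] mem_congruence_iff_Theta[OF A a b that] assms(4) a b
    by (simp add: principal_congruence_term_def)
  have unseparated: "(a, b) \<in> \<mu> \<longleftrightarrow> (\<forall>\<phi> \<in> Cm L A. \<mu> \<subseteq> \<phi> \<longrightarrow> (?o, a) \<in> \<phi> \<longleftrightarrow> (?o, b) \<in> \<phi>)"
    if \<mu>: "congruence L A \<mu>" for \<mu>
  proof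
    assume ab: "(a, b) \<in> \<mu>"
    show "\<forall>\<phi> \<in> Cm L A. \<mu> \<subseteq> \<phi> \<longrightarrow> (?o, a) \<in> \<phi> \<longleftrightarrow> (?o, b) \<in> \<phi>"
    proof (intro ballI impI)
      fix \<phi> assume "\<phi> \<in> Cm L A" "\<mu> \<subseteq> \<phi>"
      then have con: "congruence L A \<phi>" and "(a, b) \<in> \<phi>" using Cm_con ab by auto
      then show "(?o, a) \<in> \<phi> \<longleftrightarrow> (?o, b) \<in> \<phi>"
        using congruenceD(3)[OF con, of a b] congruenceD(4)[OF con, of ?o a b]
          congruenceD(4)[OF con, of ?o b a] by blast
    qed
  next
    assume same: "\<forall>\<phi> \<in> Cm L A. \<mu> \<subseteq> \<phi> \<longrightarrow> (?o, a) \<in> \<phi> \<longleftrightarrow> (?o, b) \<in> \<phi>"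
    have "homomorphic_image L A (quotient_algebra A \<mu>)"
      unfolding homomorphic_image_def using quotient_algebra[OF A \<mu>] by blast
    then have ord: "congruence_orderable L (quotient_algebra A \<mu>) one"
      using assms(3) by (simp add: strongly_fregean_def fregean_def)
    show "(a, b) \<in> \<mu>"
    proof (rule congruence_orderable_quotient[OF A assms(2) \<mu> ord a b])
      fix \<theta> assume \<theta>: "congruence L A \<theta>" "\<mu> \<subseteq> \<theta>"
      have "(?o, d) \<in> \<theta>"
        if d: "d \<in> carrier A" and c: "(?o, c) \<in> \<theta>"
          and cd: "\<forall>\<phi> \<in> Cm L A. \<mu> \<subseteq> \<phi> \<longrightarrow> (?o, c) \<in> \<phi> \<longrightarrow> (?o, d) \<in> \<phi>" for c d
      proof (rule ccontr)
        assume "(?o, d) \<notin> \<theta>"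
        then obtain \<phi> where "\<phi> \<in> Cm L A" "\<theta> \<subseteq> \<phi>" "(?o, d) \<notin> \<phi>"
          using Cm_separation[OF A o d \<theta>(1)] by blast
        then show False using cd \<theta>(2) c by blast
      qed
      from this[OF b, of a] this[OF a, of b] show "(?o, a) \<in> \<theta> \<longleftrightarrow> (?o, b) \<in> \<theta>"
        using same by blast
    qed
  qed
  have "\<mu> \<in> M L A one (binary_val A e a b) \<longleftrightarrow> \<mu> \<in> equiv_Cm L A (M L A one a) (M L A one b)"
    if "\<mu> \<in> Cm L A" for \<mu>
    using that unfolding M_def equiv_Cm_def down_Cm_def mem_Collect_eq
      principal[OF Cm_con[OF that]] unseparated[OF Cm_con[OF that]] by auto
  then show ?thesis by (auto simp: M_def equiv_Cm_def)
qed

end
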